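(* The converse Bricard property does not hold in every Moufang plane; that is, there exists a Moufang plane in which the converse Bricard property fails.
   Context: A projective plane is an incidence structure of points and lines such that: (P1) any two distinct points $A,B$ are incident with a unique line, denoted $AB$; (P2) any two distinct lines $m,n$ are incident with a unique common point, denoted $m\cap n$; (P3) there are four points no three of which are collinear. Points are collinear if they are all incident with a common line; lines are concurrent if they are all incident with a common point. A triangle is an ordered triple of noncollinear points (its vertices); its sides are the lines joining pairs of vertices. Two triangles $A_1B_1C_1$ and $A_2B_2C_2$ are (centrally) perspective from a point $O$ if the lines $A_1A_2$, $B_1B_2$, $C_1C_2$ are all incident with $O$; they are (axially) perspective from a line $l$ if the points $A_1B_1\cap A_2B_2$, $A_1C_1\cap A_2C_2$, $B_1C_1\cap B_2C_2$ are all incident with $l$. A Moufang plane is a projective plane satisfying the little Desargues property (D10): if the triangles $A_1B_1C_1$ and $A_2B_2C_2$ are perspective from a point $O$, and $O$ is incident with the line joining $A_1B_1\cap A_2B_2$ and $A_1C_1\cap A_2C_2$, then the two triangles are perspective from a line. Equivalently, a Moufang plane is a projective plane isomorphic to the projective plane over some alternative division ring $\mathcal{R}$. Here an alternative division ring is a set $\mathcal{R}$ with operations $+,\cdot$ such that $(\mathcal{R},+)$ is an abelian group with zero $0$, $a0=0a=0$ for all $a$, $(\mathcal{R}\setminus\{0\},\cdot)$ is a loop, both distributive laws hold, and $a(ab)=(aa)b$, $a(bb)=(ab)b$ for all $a,b\in\mathcal{R}$. The projective plane over $\mathcal{R}$ has points $[x,y,1]$, $[1,x,0]$, $[0,1,0]$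 ($x,y\in\mathcal{R}$), lines $\langle a,1,b\rangle$, $\langle 1,0,a\rangle$, $\langle 0,0,1\rangle$ ($a,b\in\mathcal{R}$), and $[x,y,z]$ is incident with $\langle a,b,c\rangle$ if and only if $xa+yb+zc=0$. The converse Bricard property of a projective plane is the following statement: Let $ABC$ and $A'B'C'$ be two triangles, and let $P:=BC\cap B'C'$, $Q:=AC\cap A'C'$, $R:=AB\cap A'B'$. If $D:=BC\cap AA'$, $E:=AC\cap BB'$ and $F:=AB\cap CC'$ are collinear, then the lines $A'P$, $B'Q$ and $C'R$ are concurrent. Here the triangles are assumed to be such that all the points and lines named are well defined, i.e. $A\neq A'$, $B\neq B'$, $C\neq C'$, $BC\neq B'C'$, $AC\neq A'C'$, $AB\neq A'B'$. *)

theory Defs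
  imports Complex_Main
begin

record ('p, 'l) plane =
  Pts :: "'p set"
  Lns :: "'l set"
  Inc :: "'p \<Rightarrow> 'l \<Rightarrow> bool"

definition collinear :: "('p, 'l) plane \<Rightarrow> 'p set \<Rightarrow> bool" where
  "collinear S X \<longleftrightarrow> (\<exists>l\<in>Lns S. \<forall>A\<in>X. Inc S A l)"

definition concurrent :: "('p, 'l) plane \<Rightarrow> 'l set \<Rightarrow> bool" where
  "concurrent S M \<longleftrightarrow> (\<exists>A\<in>Pts S. \<forall>l\<in>M. Inc S A l)"

definition projective_plane :: "('p, 'l) plane \<Rightarrow> bool" where
  "projective_plane S \<longleftrightarrow>
     (\<forall>A\<in>Pts S. \<forall>B\<in>Pts S. A \<noteq> B \<longrightarrow> (\<exists>!l. l \<in> Lns S \<and> Inc S A l \<and> Inc S B l)) \<and>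
     (\<forall>m\<in>Lns S. \<forall>n\<in>Lns S. m \<noteq> n \<longrightarrow> (\<exists>!A. A \<in> Pts S \<and> Inc S A m \<and> Inc S A n)) \<and>
     (\<exists>X\<subseteq>Pts S. card X = 4 \<and> (\<forall>Y\<subseteq>X. card Y = 3 \<longrightarrow> \<not> collinear S Y))"

(* join and meet are unspecified for equal arguments; every use below is
   guarded by the distinctness conditions in well_placed or follows from them. *)
definition join :: "('p, 'l) plane \<Rightarrow> 'p \<Rightarrow> 'p \<Rightarrow> 'l" where
  "join S A B = (THE l. l \<in> Lns S \<and> Inc S A l \<and> Inc S B l)"

definition meet :: "('p, 'l) plane \<Rightarrow> 'l \<Rightarrow> 'l \<Rightarrow> 'p" where
  "meet S m n = (THE A. A \<in> Pts S \<and> Inc S A m \<and> Inc S A n)"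

definition triangle :: "('p, 'l) plane \<Rightarrow> 'p \<Rightarrow> 'p \<Rightarrow> 'p \<Rightarrow> bool" where
  "triangle S A B C \<longleftrightarrow> A \<in> Pts S \<and> B \<in> Pts S \<and> C \<in> Pts S \<and> \<not> collinear S {A, B, C}"

(* Corresponding vertices and corresponding sides of the two triangles are distinct. *)
definition well_placed ::
  "('p, 'l) plane \<Rightarrow> 'p \<Rightarrow> 'p \<Rightarrow> 'p \<Rightarrow> 'p \<Rightarrow> 'p \<Rightarrow> 'p \<Rightarrow> bool" where
  "well_placed S A B C A' B' C' \<longleftrightarrow>
     A \<noteq> A' \<and> B \<noteq> B' \<and> C \<noteq> C' \<and>
     join S B C \<noteq> join S B' C' \<and> join S A C \<noteq> join S A' C' \<and> join S A B \<noteq> join S A' B'"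

definition perspective_from_point ::
  "('p, 'l) plane \<Rightarrow> 'p \<Rightarrow> 'p \<Rightarrow> 'p \<Rightarrow> 'p \<Rightarrow> 'p \<Rightarrow> 'p \<Rightarrow> 'p \<Rightarrow> bool" where
  "perspective_from_point S P A1 B1 C1 A2 B2 C2 \<longleftrightarrow>
     Inc S P (join S A1 A2) \<and> Inc S P (join S B1 B2) \<and> Inc S P (join S C1 C2)"

definition perspective_from_line ::
  "('p, 'l) plane \<Rightarrow> 'l \<Rightarrow> 'p \<Rightarrow> 'p \<Rightarrow> 'p \<Rightarrow> 'p \<Rightarrow> 'p \<Rightarrow> 'p \<Rightarrow> bool" where
  "perspective_from_line S l A1 B1 C1 A2 B2 C2 \<longleftrightarrow>
     Inc S (meet S (join S A1 B1) (join S A2 B2)) l \<and>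
     Inc S (meet S (join S A1 C1) (join S A2 C2)) l \<and>
     Inc S (meet S (join S B1 C1) (join S B2 C2)) l"

(* The two points joined in the third premise are distinct: if they coincided,
   the common point would be both A1 and A2. *)
definition little_desargues :: "('p, 'l) plane \<Rightarrow> bool" where
  "little_desargues S \<longleftrightarrow>
     (\<forall>A1 B1 C1 A2 B2 C2. \<forall>P\<in>Pts S.
        triangle S A1 B1 C1 \<longrightarrow> triangle S A2 B2 C2 \<longrightarrow>
        well_placed S A1 B1 C1 A2 B2 C2 \<longrightarrow>
        perspective_from_point S P A1 B1 C1 A2 B2 C2 \<longrightarrow>
        Inc S P (join S (meet S (join S A1 B1) (join S A2 B2))
                        (meet S (join S A1 C1) (join S A2 C2))) \<longrightarrow>
        (\<exists>l\<in>Lns S. perspective_from_line S l A1 B1 C1 A2 B2 C2))"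

definition moufang_plane :: "('p, 'l) plane \<Rightarrow> bool" where
  "moufang_plane S \<longleftrightarrow> projective_plane S \<and> little_desargues S"

definition converse_bricard :: "('p, 'l) plane \<Rightarrow> bool" where
  "converse_bricard S \<longleftrightarrow>
     (\<forall>A B C A' B' C'.
        triangle S A B C \<longrightarrow> triangle S A' B' C' \<longrightarrow> well_placed S A B C A' B' C' \<longrightarrow>
        (let P = meet S (join S B C) (join S B' C');
             Q = meet S (join S A C) (join S A' C');
             R = meet S (join S A B) (join S A' B');
             D = meet S (join S B C) (join S A A');
             E = meet S (join S A C) (join S B B');
             F = meet S (join S A B) (join S C C')
         in collinear S {D, E, F} \<longrightarrow>
            concurrent S {join S A' P, join S B' Q, join S C' R}))"

end

(* A projective plane is Moufang as soon as, for every flag (P, l), the elations with centre P and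
   axis l act transitively on the points off l of each line through P: the elation carrying A1 to A2
   carries the first triangle to the second and fixes the point where B1C1 meets the axis.
   In coordinates over an alternative division ring the maps (x, y) -> (x, y + c) show this for the
   point at infinity of the y-axis and the line at infinity; the collineations induced by
   (x + p, y + s x + q), (y, x) and (1/x, y/x), which need only the inverse laws, carry any flag to
   this one.

   For the converse Bricard property take A, B, C = the ideal points of the axes and the origin,
   and y = 1 - x for the line DEF, so that A' = (a, 1), B' = (1, b), C' = (c, -c). Over an associative
   division ring the point with homogeneous coordinates A' + B' + C' (suitably normalized) lies on
   A'P, B'Q and C'R, so a, b, c must generate a nonassociative algebra; the octonions a = 1 + e1,
   b = -e2, c = 1 + e4 work. *)
theory Submission
  imports Defs
begin

section \<open>Elations and the little Desargues property\<close>

locale proj_plane =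
  fixes S :: "('p, 'l) plane"
  assumes projective: "projective_plane S"
begin

lemma ex1_line: "\<lbrakk>A \<in> Pts S; B \<in> Pts S; A \<noteq> B\<rbrakk> \<Longrightarrow> \<exists>!l. l \<in> Lns S \<and> Inc S A l \<and> Inc S B l"
  using projective by (simp add: projective_plane_def)

lemma ex1_point: "\<lbrakk>m \<in> Lns S; n \<in> Lns S; m \<noteq> n\<rbrakk> \<Longrightarrow> \<exists>!A. A \<in> Pts S \<and> Inc S A m \<and> Inc S A n"
  using projective by (simp add: projective_plane_def)

lemma line_unique:
  "\<lbrakk>A \<in> Pts S; B \<in> Pts S; A \<noteq> B; l \<in> Lns S; m \<in> Lns S; Inc S A l; Inc S B l; Inc S A m; Inc S B m\<rbrakk>
    \<Longrightarrow> l = m"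
  using ex1_line[of A B] by blast

lemma join:
  assumes "A \<in> Pts S" "B \<in> Pts S" "A \<noteq> B"
  shows join_closed: "join S A B \<in> Lns S"
    and join_left: "Inc S A (join S A B)"
    and join_right: "Inc S B (join S A B)"
  using theI'[OF ex1_line[OF assms]] unfolding join_def by blast+

lemma join_eq:
  "\<lbrakk>A \<in> Pts S; B \<in> Pts S; A \<noteq> B; l \<in> Lns S; Inc S A l; Inc S B l\<rbrakk> \<Longrightarrow> join S A B = l"
  using join[of A B] ex1_line[of A B] by blast

lemma meet:
  assumes "m \<in> Lns S" "n \<in> Lns S" "m \<noteq> n"
  shows meet_closed: "meet S m n \<in> Pts S"
    and meet_left: "Inc S (meet S m n) m"
    and meet_right: "Inc S (meet S m n) n"
  using theI'[OF ex1_point[OF assms]] unfolding meet_def by blast+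

lemma meet_eq:
  "\<lbrakk>m \<in> Lns S; n \<in> Lns S; m \<noteq> n; A \<in> Pts S; Inc S A m; Inc S A n\<rbrakk> \<Longrightarrow> meet S m n = A"
  using meet[of m n] ex1_point[of m n] by blast

lemma ex_line_through:
  assumes "A \<in> Pts S"
  shows "\<exists>l\<in>Lns S. Inc S A l"
proof -
  obtain X where X: "X \<subseteq> Pts S" "card X = 4"
    using projective by (auto simp: projective_plane_def)
  then have "\<not> X \<subseteq> {A}"
    using card_mono[of "{A}" X] by auto
  then obtain B where "B \<in> Pts S" "A \<noteq> B"
    using X(1) by blast
  then show ?thesis
    using join[of A B] assms by blast
qed

text \<open>Any two points, equal or not, lie on a common line, so a repeated vertex would make the
  three vertices collinear.\<close>

lemma triangle_distinct:
  assumes "triangle S A B C"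
  shows "A \<noteq> B" "A \<noteq> C" "B \<noteq> C"
proof -
  have non: "\<not> (Inc S A l \<and> Inc S B l \<and> Inc S C l)" if "l \<in> Lns S" for l
    using assms that by (auto simp: triangle_def collinear_def)
  have line: "\<exists>l\<in>Lns S. Inc S X l \<and> Inc S Y l" if "X \<in> Pts S" "Y \<in> Pts S" for X Y
    using that join[of X Y] ex_line_through[of X] by (cases "X = Y") auto
  show "A \<noteq> B" using line[of A C] non assms by (auto simp: triangle_def)
  show "A \<noteq> C" using line[of A B] non assms by (auto simp: triangle_def)
  show "B \<noteq> C" using line[of A B] non assms by (auto simp: triangle_def)
qed

end

lemma join_commute: "join S A B = join S B A"
  by (simp add: join_def conj_ac)

section \<open>Isomorphisms of planes and transitivity of elations\<close>

definition plane_iso ::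
  "('p, 'l) plane \<Rightarrow> ('q, 'k) plane \<Rightarrow> ('p \<Rightarrow> 'q) \<Rightarrow> ('l \<Rightarrow> 'k) \<Rightarrow> bool" where
  "plane_iso S T f g \<longleftrightarrow> bij_betw f (Pts S) (Pts T) \<and> bij_betw g (Lns S) (Lns T) \<and>
     (\<forall>A\<in>Pts S. \<forall>l\<in>Lns S. Inc T (f A) (g l) \<longleftrightarrow> Inc S A l)"

lemma plane_isoD:
  assumes "plane_iso S T f g"
  shows plane_iso_Pts: "A \<in> Pts S \<Longrightarrow> f A \<in> Pts T"
    and plane_iso_Lns: "l \<in> Lns S \<Longrightarrow> g l \<in> Lns T"
    and plane_iso_Inc: "A \<in> Pts S \<Longrightarrow> l \<in> Lns S \<Longrightarrow> Inc T (f A) (g l) \<longleftrightarrow> Inc S A l"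
  using assms unfolding plane_iso_def by (auto dest: bij_betwE)

lemma plane_iso_bij:
  assumes "plane_iso S T f g"
  shows "Pts T = f ` Pts S" "Lns T = g ` Lns S" "inj_on f (Pts S)" "inj_on g (Lns S)"
proof -
  have bij: "bij_betw f (Pts S) (Pts T)" "bij_betw g (Lns S) (Lns T)"
    using assms unfolding plane_iso_def by simp_all
  show "Pts T = f ` Pts S" "Lns T = g ` Lns S"
    using bij_betw_imp_surj_on[OF bij(1)] bij_betw_imp_surj_on[OF bij(2)] by simp_all
  show "inj_on f (Pts S)" "inj_on g (Lns S)"
    using bij_betw_imp_inj_on[OF bij(1)] bij_betw_imp_inj_on[OF bij(2)] by simp_all
qed

lemma plane_iso_comp:
  assumes "plane_iso S T f g" "plane_iso T U f' g'"
  shows "plane_iso S U (f' \<circ> f) (g' \<circ> g)"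
  using assms plane_isoD[OF assms(1)] unfolding plane_iso_def
  by (auto intro: bij_betw_trans)

lemma plane_iso_inv:
  assumes "plane_iso S T f g"
  shows "plane_iso T S (inv_into (Pts S) f) (inv_into (Lns S) g)"
proof -
  have bij: "bij_betw f (Pts S) (Pts T)" "bij_betw g (Lns S) (Lns T)"
    using assms unfolding plane_iso_def by auto
  have "Inc S (inv_into (Pts S) f A) (inv_into (Lns S) g l) \<longleftrightarrow> Inc T A l"
    if "A \<in> Pts T" "l \<in> Lns T" for A l
    using that plane_iso_Inc[OF assms, of "inv_into (Pts S) f A" "inv_into (Lns S) g l"] bij
    by (simp add: bij_betw_inv_into_right bij_betwE[OF bij_betw_inv_into])
  then show ?thesis
    using bij by (simp add: plane_iso_def bij_betw_inv_into)
qed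

text \<open>The condition \<open>unique\<close> is self-dual: it yields uniqueness of joins and of
  meets at once, leaving only the two existence claims.\<close>

lemma projective_planeI:
  assumes line: "\<And>A B. A \<in> Pts S \<Longrightarrow> B \<in> Pts S \<Longrightarrow> A \<noteq> B \<Longrightarrow> \<exists>l\<in>Lns S. Inc S A l \<and> Inc S B l"
    and point: "\<And>m n. m \<in> Lns S \<Longrightarrow> n \<in> Lns S \<Longrightarrow> m \<noteq> n \<Longrightarrow> \<exists>A\<in>Pts S. Inc S A m \<and> Inc S A n"
    and unique: "\<And>A B m n. \<lbrakk>A \<in> Pts S; B \<in> Pts S; m \<in> Lns S; n \<in> Lns S;
       Inc S A m; Inc S A n; Inc S B m; Inc S B n\<rbrakk> \<Longrightarrow> A = B \<or> m = n"
    and quadrangle: "\<exists>X\<subseteq>Pts S. card X = 4 \<and> (\<forall>Y\<subseteq>X. card Y = 3 \<longrightarrow> \<not> collinear S Y)"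
  shows "projective_plane S"
  unfolding projective_plane_def
proof (intro conjI ballI impI)
  fix A B assume AB: "A \<in> Pts S" "B \<in> Pts S" "A \<noteq> B"
  then obtain l where l: "l \<in> Lns S" "Inc S A l" "Inc S B l" using line by blast
  show "\<exists>!l. l \<in> Lns S \<and> Inc S A l \<and> Inc S B l"
    using l AB unique[of A B] by blast
next
  fix m n assume mn: "m \<in> Lns S" "n \<in> Lns S" "m \<noteq> n"
  then obtain A where A: "A \<in> Pts S" "Inc S A m" "Inc S A n" using point by blast
  show "\<exists>!A. A \<in> Pts S \<and> Inc S A m \<and> Inc S A n"
    using A mn unique[of _ A m n] by blast
qed (rule quadrangle)

lemma projective_plane_iso:
  assumes iso: "plane_iso S T f g" and S: "projective_plane S"
  shows "projective_plane T"
proof -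
  interpret proj_plane S by (rule proj_plane.intro[OF S])
  note Pts = plane_iso_bij(1)[OF iso] and Lns = plane_iso_bij(2)[OF iso] and inj =
    plane_iso_bij(3)[OF iso]
  note inc = plane_iso_Inc[OF iso]
  show ?thesis
  proof (rule projective_planeI)
    fix A B assume "A \<in> Pts T" "B \<in> Pts T" "A \<noteq> B"
    then obtain a b where ab: "a \<in> Pts S" "b \<in> Pts S" "a \<noteq> b" "A = f a" "B = f b"
      unfolding Pts by blast
    then show "\<exists>l\<in>Lns T. Inc T A l \<and> Inc T B l"
      using join[of a b] inc by (auto simp: Lns)
  next
    fix m n assume "m \<in> Lns T" "n \<in> Lns T" "m \<noteq> n"
    then obtain m' n' where "m' \<in> Lns S" "n' \<in> Lns S" "m' \<noteq> n'" "m = g m'" "n = g n'"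
      unfolding Lns by blast
    then show "\<exists>A\<in>Pts T. Inc T A m \<and> Inc T A n"
      using meet[of m' n'] inc by (auto simp: Pts)
  next
    fix A B m n
    assume *: "A \<in> Pts T" "B \<in> Pts T" "m \<in> Lns T" "n \<in> Lns T"
      "Inc T A m" "Inc T A n" "Inc T B m" "Inc T B n"
    obtain a b where ab: "a \<in> Pts S" "b \<in> Pts S" "A = f a" "B = f b"
      using * unfolding Pts by blast
    obtain m' n' where mn: "m' \<in> Lns S" "n' \<in> Lns S" "m = g m'" "n = g n'"
      using * unfolding Lns by blast
    show "A = B \<or> m = n"
      using * ab mn inc line_unique[of a b m' n'] by auto
  next
    obtain X where X: "X \<subseteq> Pts S" "card X = 4" "\<And>Y. Y \<subseteq> X \<Longrightarrow> card Y = 3 \<Longrightarrow> \<not> collinear S Y"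
      using S unfolding projective_plane_def by auto
    have "\<not> collinear T Y" if Y: "Y \<subseteq> f ` X" "card Y = 3" for Y
    proof
      assume coll: "collinear T Y"
      \<comment> \<open>Lifting \<open>Y\<close> to a subset of \<open>X\<close> keeps its size
        because \<open>f\<close> is injective, so a collinear triple in the image would come from
        one in the quadrangle.\<close>
      obtain Y' where Y': "Y' \<subseteq> X" "Y = f ` Y'"
        using Y(1) by (meson subset_imageE)
      then have "card Y' = 3"
        using Y(2) card_image[OF inj_on_subset[OF inj, of Y']] X(1) by auto
      moreover have "collinear S Y'"
        using coll Y' X(1) inc unfolding collinear_def Lns by (auto simp: subset_iff)
      ultimately show False using X(3) Y'(1) by blast
    qed
    then show "\<exists>X\<subseteq>Pts T. card X = 4 \<and> (\<forall>Y\<subseteq>X. card Y = 3 \<longrightarrow> \<not> collinear T Y)"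
      using X(1,2) card_image[OF inj_on_subset[OF inj X(1)]]
      by (intro exI[of _ "f ` X"]) (auto simp: Pts)
  qed
qed

text \<open>Known as (P, l)-transitivity: the pair \<open>f\<close>, \<open>g\<close> is a central
  collineation with centre \<open>P\<close> and axis \<open>l\<close>, an elation when
  \<open>P\<close> lies on \<open>l\<close>.\<close>

definition elation_transitive :: "('p, 'l) plane \<Rightarrow> 'p \<Rightarrow> 'l \<Rightarrow> bool" where
  "elation_transitive S P l \<longleftrightarrow>
     (\<forall>A\<in>Pts S. \<forall>B\<in>Pts S. \<not> Inc S A l \<longrightarrow> \<not> Inc S B l \<longrightarrow> collinear S {P, A, B} \<longrightarrow>
       (\<exists>f g. plane_iso S S f g \<and> f A = B \<and>
         (\<forall>X\<in>Pts S. Inc S X l \<longrightarrow> f X = X) \<and> (\<forall>m\<in>Lns S. Inc S P m \<longrightarrow> g m = m)))"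

text \<open>Conjugation with the isomorphism carries the collineations for \<open>P\<close> and
  \<open>l\<close> to those for \<open>f P\<close> and \<open>g l\<close>.\<close>

lemma elation_transitive_iso:
  assumes iso: "plane_iso S T f g" and P: "P \<in> Pts S" and l: "l \<in> Lns S"
    and trans: "elation_transitive S P l"
  shows "elation_transitive T (f P) (g l)"
  unfolding elation_transitive_def
proof (intro ballI impI)
  fix A B
  assume A: "A \<in> Pts T" "\<not> Inc T A (g l)" and B: "B \<in> Pts T" "\<not> Inc T B (g l)"
    and coll: "collinear T {f P, A, B}"
  note Pts = plane_iso_bij(1)[OF iso] and Lns = plane_iso_bij(2)[OF iso] and inj =
    plane_iso_bij(3,4)[OF iso]
  note inc = plane_iso_Inc[OF iso]
  obtain a b where ab: "a \<in> Pts S" "b \<in> Pts S" "A = f a" "B = f b"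
    using A B Pts by blast
  have "collinear S {P, a, b}" "\<not> Inc S a l" "\<not> Inc S b l"
    using coll A B ab P l inc Lns unfolding collinear_def by auto
  then obtain h k where hk: "plane_iso S S h k" "h a = b"
    "\<And>X. X \<in> Pts S \<Longrightarrow> Inc S X l \<Longrightarrow> h X = X" "\<And>m. m \<in> Lns S \<Longrightarrow> Inc S P m \<Longrightarrow> k m = m"
    using trans[unfolded elation_transitive_def, rule_format, of a b] ab by blast
  let ?f = "f \<circ> h \<circ> inv_into (Pts S) f" and ?g = "g \<circ> k \<circ> inv_into (Lns S) g"
  have "plane_iso T T ?f ?g"
    using plane_iso_comp[OF plane_iso_inv[OF iso] plane_iso_comp[OF hk(1) iso]]
    by (simp add: comp_assoc)
  moreover have "?f A = B"
    using ab hk(2) inj(1) by simp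
  moreover have "\<forall>X\<in>Pts T. Inc T X (g l) \<longrightarrow> ?f X = X"
    using hk(3) inc l inj(1) unfolding Pts by auto
  moreover have "\<forall>m\<in>Lns T. Inc T (f P) m \<longrightarrow> ?g m = m"
    using hk(4) inc P inj(2) unfolding Lns by auto
  ultimately show "\<exists>f' g'. plane_iso T T f' g' \<and> f' A = B \<and>
      (\<forall>X\<in>Pts T. Inc T X (g l) \<longrightarrow> f' X = X) \<and> (\<forall>m\<in>Lns T. Inc T (f P) m \<longrightarrow> g' m = m)"
    by (intro exI[of _ ?f] exI[of _ ?g] conjI)
qed

section \<open>Pairs of triangles perspective from a point\<close>

locale central_triangles = proj_plane S for S :: "('p, 'l) plane" +
  fixes A1 B1 C1 A2 B2 C2 P :: 'p
  assumes triangle1: "triangle S A1 B1 C1" and triangle2: "triangle S A2 B2 C2"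
    and placed: "well_placed S A1 B1 C1 A2 B2 C2"
    and centre: "P \<in> Pts S" "perspective_from_point S P A1 B1 C1 A2 B2 C2"
begin

text \<open>The hypotheses are symmetric in \<open>B\<close> and \<open>C\<close>, so facts about
  the sides \<open>A1 B1\<close>, \<open>A2 B2\<close> carry over to \<open>A1 C1\<close>,
  \<open>A2 C2\<close>.\<close>

lemma swap_vertices: "central_triangles S A1 C1 B1 A2 C2 B2 P"
  using triangle1 triangle2 placed centre
  by unfold_locales
    (simp_all add: triangle_def well_placed_def perspective_from_point_def
      insert_commute[of C1 B1] insert_commute[of C2 B2] join_commute[of S C1 B1] join_commute[of S
        C2 B2])

lemma swap_triangles: "central_triangles S A2 B2 C2 A1 B1 C1 P"
  using triangle1 triangle2 placed centre
  by unfold_locales (auto simp: triangle_def well_placed_def perspective_from_point_def join_commute)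

lemma vertices:
  "A1 \<in> Pts S" "B1 \<in> Pts S" "C1 \<in> Pts S" "A2 \<in> Pts S" "B2 \<in> Pts S" "C2 \<in> Pts S"
  "A1 \<noteq> B1" "A1 \<noteq> C1" "B1 \<noteq> C1" "A2 \<noteq> B2" "A2 \<noteq> C2" "B2 \<noteq> C2"
  "A1 \<noteq> A2" "B1 \<noteq> B2" "C1 \<noteq> C2"
  using triangle1 triangle2 placed triangle_distinct[OF triangle1] triangle_distinct[OF triangle2]
  by (auto simp: triangle_def well_placed_def)

lemma sides:
  "join S A1 B1 \<noteq> join S A2 B2" "join S A1 C1 \<noteq> join S A2 C2" "join S B1 C1 \<noteq> join S B2 C2"
  using placed by (auto simp: well_placed_def)

lemma not_on_side:
  "\<not> (l \<in> Lns S \<and> Inc S A1 l \<and> Inc S B1 l \<and> Inc S C1 l)"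
  "\<not> (l \<in> Lns S \<and> Inc S A2 l \<and> Inc S B2 l \<and> Inc S C2 l)"
  using triangle1 triangle2 by (auto simp: triangle_def collinear_def)

lemma on_centre: "Inc S P (join S A1 A2)" "Inc S P (join S B1 B2)" "Inc S P (join S C1 C2)"
  using centre by (auto simp: perspective_from_point_def)

text \<open>Here the axis would be \<open>A1 B1\<close>, which no elation moving \<open>A1\<close>
  can have. Since \<open>A1\<close> lies on \<open>A2 C2\<close>, the lines \<open>A1 A2\<close> and
  \<open>A2 C2\<close> agree, so the centre lies on both \<open>A1 B1\<close> and
  \<open>A2 C2\<close>.\<close>

lemma third_meet_if_vertex_on_side:
  assumes P: "Inc S P (join S A1 B1)" and A1: "Inc S A1 (join S A2 C2)"
  shows "Inc S (meet S (join S B1 C1) (join S B2 C2)) (join S A1 B1)"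
proof -
  define l where "l = join S A1 B1"
  have l: "l \<in> Lns S" "Inc S A1 l" "Inc S B1 l" "Inc S P l"
    using join vertices P unfolding l_def by auto
  have aa: "join S A1 A2 = join S A2 C2"
    by (rule join_eq) (use join vertices A1 in auto)
  have P_aa: "Inc S P (join S A2 C2)"
    using on_centre aa by metis
  show ?thesis
  proof (cases "join S A2 C2 = l")
    \<comment> \<open>Now \<open>A2\<close> and \<open>C2\<close> lie on \<open>l\<close> as well.
      Noncollinearity of the second triangle forces \<open>P = B1\<close>, that of the first forces
      \<open>C2 = B1\<close>, and this point is the third meet.\<close>
    case True
    then have A2: "Inc S A2 l" and C2: "Inc S C2 l"
      using join vertices by metis+
    have "P = B1"
    proof (rule ccontr)
      assume "P \<noteq> B1"
      then have "l = join S B1 B2"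
        using line_unique[of P B1 l "join S B1 B2"] l join vertices centre on_centre by auto
      then show False
        using not_on_side(2)[of l] A2 C2 l join vertices by auto
    qed
    have "C2 = B1"
    proof (rule ccontr)
      assume "C2 \<noteq> B1"
      then have "l = join S C1 C2"
        using line_unique[of B1 C2 l "join S C1 C2"] l C2 join vertices on_centre \<open>P = B1\<close> by auto
      then show False
        using not_on_side(1)[of l] l join vertices by auto
    qed
    then have "meet S (join S B1 C1) (join S B2 C2) = B1"
      by (intro meet_eq) (use join vertices sides in auto)
    then show ?thesis using l l_def by simp
  next
    \<comment> \<open>Two distinct lines through \<open>P\<close> and \<open>A1\<close> force
      \<open>P = A1\<close>. Then \<open>l\<close> is \<open>B1 B2\<close>, and \<open>C2\<close>
      must be \<open>A1\<close>, so \<open>B2 C2\<close> is \<open>l\<close> itself.\<close>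
    case False
    then have "P = A1"
      using line_unique[of P A1 l "join S A2 C2"] l P_aa A1 centre vertices join by blast
    have "l = join S B1 B2"
      using line_unique[of A1 B1 l "join S B1 B2"] l join vertices on_centre \<open>P = A1\<close> by auto
    then have B2: "Inc S B2 l"
      using join vertices by auto
    have "join S A1 C1 = join S C1 C2"
      by (rule join_eq) (use join vertices on_centre \<open>P = A1\<close> in auto)
    then have "Inc S C2 (join S A1 C1)"
      using join vertices by auto
    then have "C2 = A1"
      using line_unique[of A1 C2 "join S A1 C1" "join S A2 C2"] A1 join vertices sides by blast
    then have "join S B2 C2 = l"
      by (intro join_eq) (use join vertices l B2 in auto)
    then show ?thesis
      using meet_right join vertices sides l_def by metis
  qed
qed

text \<open>If the axis misses \<open>A1\<close> and \<open>A2\<close>, the elation carrying \<open>A1\<close> to \<open>A2\<close> carries the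
  first triangle to the second, hence fixes the third meet.\<close>

lemma image_of_vertex:
  assumes fg: "plane_iso S S f g" "f A1 = A2"
    and axis: "l \<in> Lns S" "\<And>X. X \<in> Pts S \<Longrightarrow> Inc S X l \<Longrightarrow> f X = X"
    and cent: "\<And>m. m \<in> Lns S \<Longrightarrow> Inc S P m \<Longrightarrow> g m = m"
    and X: "Inc S (meet S (join S A1 B1) (join S A2 B2)) l"
    and off: "\<not> Inc S A1 l" "\<not> Inc S A2 l"
    and P: "Inc S P l"
  shows "f B1 = B2"
proof -
  define X where "X = meet S (join S A1 B1) (join S A2 B2)"
  have X': "X \<in> Pts S" "Inc S X (join S A1 B1)" "Inc S X (join S A2 B2)" "Inc S X l"
    using meet join vertices sides assms(6) unfolding X_def by auto
  note iso = plane_isoD[OF fg(1)]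
  \<comment> \<open>The image of this side passes through \<open>f A1 = A2\<close> and through the
    axis point \<open>X\<close>, which is fixed.\<close>
  have "g (join S A1 B1) = join S A2 B2"
  proof (rule line_unique[of A2 X])
    show "A2 \<noteq> X" using X' off by auto
    show "Inc S A2 (g (join S A1 B1))"
      using iso(3)[of A1 "join S A1 B1"] fg(2) join vertices by auto
    show "Inc S X (g (join S A1 B1))"
      using iso(3)[of X "join S A1 B1"] axis(2)[of X] X' join vertices by auto
  qed (use X' join vertices iso in auto)
  then have 1: "Inc S (f B1) (join S A2 B2)"
    using iso(3)[of B1 "join S A1 B1"] join vertices by auto
  \<comment> \<open>The line \<open>B1 B2\<close> passes through the centre, so \<open>g\<close>
    fixes it.\<close>
  have 2: "Inc S (f B1) (join S B1 B2)"
    using iso(3)[of B1 "join S B1 B2"] cent[of "join S B1 B2"] join vertices on_centre by auto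
  \<comment> \<open>If they agreed, the line would contain \<open>P\<close> and \<open>A2\<close>,
    hence be \<open>A1 A2\<close> too, and so contain \<open>A1\<close> and
    \<open>B1\<close>.\<close>
  have "join S A2 B2 \<noteq> join S B1 B2"
  proof
    assume eq: "join S A2 B2 = join S B1 B2"
    have "P \<noteq> A2" using P off by auto
    moreover have "Inc S A2 (join S B1 B2)"
      using eq join_left[of A2 B2] vertices by simp
    ultimately have "join S A2 B2 = join S A1 A2"
      using line_unique[of P A2 "join S A2 B2" "join S A1 A2"] eq on_centre join vertices centre
      by simp
    then have "join S A1 B1 = join S A2 B2"
      using eq by (intro join_eq) (use join vertices in metis)+
    then show False using sides by simp
  qed
  then show "f B1 = B2"
    using line_unique[of "f B1" B2 "join S A2 B2" "join S B1 B2"] 1 2 iso(1) join vertices by metis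
qed

lemma third_meet_if_axis_misses:
  assumes trans: "elation_transitive S P l" and l: "l \<in> Lns S" "Inc S P l"
    and X: "Inc S (meet S (join S A1 B1) (join S A2 B2)) l"
    and Y: "Inc S (meet S (join S A1 C1) (join S A2 C2)) l"
    and off: "\<not> Inc S A1 l" "\<not> Inc S A2 l"
  shows "Inc S (meet S (join S B1 C1) (join S B2 C2)) l"
proof -
  have "collinear S {P, A1, A2}"
    unfolding collinear_def
    by (rule bexI[of _ "join S A1 A2"]) (use join vertices on_centre in auto)
  then obtain f g where fg: "plane_iso S S f g" "f A1 = A2"
    and axis: "\<And>X. X \<in> Pts S \<Longrightarrow> Inc S X l \<Longrightarrow> f X = X"
    and cent: "\<And>m. m \<in> Lns S \<Longrightarrow> Inc S P m \<Longrightarrow> g m = m"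
    using trans[unfolded elation_transitive_def, rule_format, of A1 A2] off vertices by blast
  note iso = plane_isoD[OF fg(1)]
  interpret sw: central_triangles S A1 C1 B1 A2 C2 B2 P
    by (rule swap_vertices)
  have "f B1 = B2"
    by (rule image_of_vertex[OF fg l(1) axis cent X off l(2)])
  moreover have "f C1 = C2"
    by (rule sw.image_of_vertex[OF fg l(1) axis cent Y off l(2)])
  ultimately have side: "g (join S B1 C1) = join S B2 C2"
    using iso(3)[of B1 "join S B1 C1"] iso(3)[of C1 "join S B1 C1"] join iso(2) vertices
    by (metis join_eq)
  show ?thesis
  proof (cases "join S B1 C1 = l")
    case True
    then show ?thesis using meet_left join vertices sides by metis
  next
    case False
    \<comment> \<open>The point where \<open>B1 C1\<close> meets the axis is fixed, so it also lies
      on the image line \<open>B2 C2\<close>.\<close>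
    define W where "W = meet S (join S B1 C1) l"
    have W: "W \<in> Pts S" "Inc S W (join S B1 C1)" "Inc S W l"
      using meet[of "join S B1 C1" l] join vertices l False unfolding W_def by auto
    then have "Inc S W (join S B2 C2)"
      using iso(3)[of W "join S B1 C1"] axis[of W] side join vertices by auto
    then have "meet S (join S B1 C1) (join S B2 C2) = W"
      by (intro meet_eq) (use join vertices sides W in auto)
    then show ?thesis using W by simp
  qed
qed

text \<open>A side through \<open>A1\<close> other than the axis meets the axis only in
  \<open>A1\<close>, so its meet with the corresponding side is \<open>A1\<close>. It turns out that
  exactly one of the two sides through \<open>A1\<close> is the axis, which is the situation of
  \<open>third_meet_if_vertex_on_side\<close> up to exchanging \<open>B\<close> and
  \<open>C\<close>.\<close>

lemma third_meet_if_axis_through_vertex: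
  assumes l: "l \<in> Lns S" "Inc S P l"
    and X: "Inc S (meet S (join S A1 B1) (join S A2 B2)) l"
    and Y: "Inc S (meet S (join S A1 C1) (join S A2 C2)) l"
    and A1: "Inc S A1 l"
  shows "Inc S (meet S (join S B1 C1) (join S B2 C2)) l"
proof -
  define X where "X = meet S (join S A1 B1) (join S A2 B2)"
  define Y where "Y = meet S (join S A1 C1) (join S A2 C2)"
  interpret sw: central_triangles S A1 C1 B1 A2 C2 B2 P
    by (rule swap_vertices)
  have X': "X \<in> Pts S" "Inc S X (join S A1 B1)" "Inc S X (join S A2 B2)" "Inc S X l"
    using meet join vertices sides X unfolding X_def by auto
  have Y': "Y \<in> Pts S" "Inc S Y (join S A1 C1)" "Inc S Y (join S A2 C2)" "Inc S Y l"
    using meet join vertices sides Y unfolding Y_def by auto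
  have X_A1: "X = A1" if "l \<noteq> join S A1 B1"
    using line_unique[of X A1 l "join S A1 B1"] that X' A1 l join vertices by blast
  have Y_A1: "Y = A1" if "l \<noteq> join S A1 C1"
    using line_unique[of Y A1 l "join S A1 C1"] that Y' A1 l join vertices by blast
  have "join S A1 B1 \<noteq> join S A1 C1"
    using not_on_side(1)[of "join S A1 B1"] join vertices by metis
  \<comment> \<open>If both meets were \<open>A1\<close>, the sides \<open>A2 B2\<close> and
    \<open>A2 C2\<close> would share \<open>A1\<close> and \<open>A2\<close> and coincide.\<close>
  moreover have "\<not> (X = A1 \<and> Y = A1)"
  proof
    assume eq: "X = A1 \<and> Y = A1"
    then have "join S A2 B2 = join S A2 C2"
      using line_unique[of A1 A2 "join S A2 B2" "join S A2 C2"] X' Y' join vertices by metis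
    then show False
      using not_on_side(2)[of "join S A2 B2"] join vertices by metis
  qed
  ultimately consider "l = join S A1 B1" "Y = A1" | "l = join S A1 C1" "X = A1"
    using X_A1 Y_A1 by metis
  then show ?thesis
  proof cases
    case 1
    then show ?thesis
      using third_meet_if_vertex_on_side l Y' by simp
  next
    case 2
    then show ?thesis
      using sw.third_meet_if_vertex_on_side l X' by (simp add: join_commute)
  qed
qed

end

text \<open>The axis is the line joining the first two meets. If it contains \<open>A1\<close> or
  \<open>A2\<close>, incidence arguments replace the elation, with the triangles exchanged in the
  second case.\<close>

theorem little_desargues_if_elation_transitive:
  assumes "projective_plane S"
    and trans: "\<And>P l. P \<in> Pts S \<Longrightarrow> l \<in> Lns S \<Longrightarrow> Inc S P l \<Longrightarrow> elation_transitive S P l"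
  shows "little_desargues S"
  unfolding little_desargues_def
proof (intro allI ballI impI)
  fix A1 B1 C1 A2 B2 C2 P
  assume P: "P \<in> Pts S" and tri: "triangle S A1 B1 C1" "triangle S A2 B2 C2"
    and placed: "well_placed S A1 B1 C1 A2 B2 C2"
    and persp: "perspective_from_point S P A1 B1 C1 A2 B2 C2"
  interpret central_triangles S A1 B1 C1 A2 B2 C2 P
    by unfold_locales (fact assms tri placed P persp)+
  interpret swap: central_triangles S A2 B2 C2 A1 B1 C1 P
    by (rule swap_triangles)
  define X where "X = meet S (join S A1 B1) (join S A2 B2)"
  define Y where "Y = meet S (join S A1 C1) (join S A2 C2)"
  assume "Inc S P (join S (meet S (join S A1 B1) (join S A2 B2)) (meet S (join S A1 C1) (join S A2
    C2)))"
  then have P_on: "Inc S P (join S X Y)" unfolding X_def Y_def .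
  have X: "X \<in> Pts S" "Inc S X (join S A1 B1)" "Inc S X (join S A2 B2)"
    using meet join vertices sides unfolding X_def by auto
  have Y: "Y \<in> Pts S" "Inc S Y (join S A1 C1)" "Inc S Y (join S A2 C2)"
    using meet join vertices sides unfolding Y_def by auto
  have "X \<noteq> Y"
  proof
    assume "X = Y"
    have "join S A1 B1 \<noteq> join S A1 C1" "join S A2 B2 \<noteq> join S A2 C2"
      using not_on_side join vertices by metis+
    then have "X = A1" "X = A2"
      using line_unique[of X A1 "join S A1 B1" "join S A1 C1"]
        line_unique[of X A2 "join S A2 B2" "join S A2 C2"] \<open>X = Y\<close> X Y join vertices by blast+
    then show False using vertices by simp
  qed
  define l where "l = join S X Y"
  have l: "l \<in> Lns S" "Inc S P l" "Inc S X l" "Inc S Y l"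
    using join X Y \<open>X \<noteq> Y\<close> P_on unfolding l_def by auto
  have "Inc S (meet S (join S B1 C1) (join S B2 C2)) l"
  proof (cases "Inc S A1 l \<or> Inc S A2 l")
    case False
    then show ?thesis
      using third_meet_if_axis_misses[OF trans[OF P l(1,2)]] l unfolding X_def Y_def by blast
  next
    case True
    have comm: "meet S m n = meet S n m" for m n
      by (simp add: meet_def conj_ac)
    show ?thesis
      using True third_meet_if_axis_through_vertex[of l] swap.third_meet_if_axis_through_vertex[of l] l
      unfolding X_def Y_def by (metis comm)
  qed
  then show "\<exists>l\<in>Lns S. perspective_from_line S l A1 B1 C1 A2 B2 C2"
    using l unfolding perspective_from_line_def X_def Y_def by blast
qed

section \<open>Planes over alternative division rings\<close>

text \<open>The inverse laws replace the alternative laws, from which they follow; the coordinate plane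
  needs nothing more.\<close>

class alternative_division_ring = ab_group_add + zero_neq_one + times + inverse +
  assumes alt_distrib_left: "a * (b + c) = a * b + a * c"
    and alt_distrib_right: "(a + b) * c = a * c + b * c"
    and alt_mult_1_left: "1 * a = a"
    and alt_mult_1_right: "a * 1 = a"
    and inverse_mult_cancel_left: "a \<noteq> 0 \<Longrightarrow> inverse a * (a * b) = b"
    and inverse_mult_cancel_right: "a \<noteq> 0 \<Longrightarrow> (b * a) * inverse a = b"
begin

lemma alt_mult_zero: "0 * a = 0" "a * 0 = 0"
  using alt_distrib_right[of 0 0 a] alt_distrib_left[of a 0 0] by simp_all

lemma alt_mult_minus: "(- a) * b = - (a * b)" "a * (- b) = - (a * b)"
proof -
  have "a * b + (- a) * b = 0"
    using alt_distrib_right[of a "- a" b] by (simp add: alt_mult_zero)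
  then show "(- a) * b = - (a * b)"
    by (simp add: minus_unique)
  have "a * b + a * (- b) = 0"
    using alt_distrib_left[of a b "- b"] by (simp add: alt_mult_zero)
  then show "a * (- b) = - (a * b)"
    by (simp add: minus_unique)
qed

lemma alt_left_diff_distrib: "(a - b) * c = a * c - b * c"
  using alt_distrib_right[of a "- b" c] by (simp add: alt_mult_minus)

lemma alt_right_diff_distrib: "a * (b - c) = a * b - a * c"
  using alt_distrib_left[of a b "- c"] by (simp add: alt_mult_minus)

lemma alt_inverse_nonzero: "a \<noteq> 0 \<Longrightarrow> inverse a \<noteq> 0"
  using inverse_mult_cancel_left[of a 1] alt_mult_zero(1) zero_neq_one by metis

lemma alt_inverse_inverse: "a \<noteq> 0 \<Longrightarrow> inverse (inverse a) = a"
  using inverse_mult_cancel_left[of "inverse a" a] inverse_mult_cancel_left[of a 1]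
  by (simp add: alt_inverse_nonzero alt_mult_1_right)

lemma mult_inverse_cancel_left: "a \<noteq> 0 \<Longrightarrow> a * (inverse a * b) = b"
  using inverse_mult_cancel_left[of "inverse a" b]
  by (simp add: alt_inverse_nonzero alt_inverse_inverse)

lemma mult_inverse_cancel_right: "a \<noteq> 0 \<Longrightarrow> (b * inverse a) * a = b"
  using inverse_mult_cancel_right[of "inverse a" b]
  by (simp add: alt_inverse_nonzero alt_inverse_inverse)

lemma alt_mult_eq_left: "a \<noteq> 0 \<Longrightarrow> a * b = c \<longleftrightarrow> b = inverse a * c"
  using inverse_mult_cancel_left mult_inverse_cancel_left by auto

lemma alt_mult_eq_right: "a \<noteq> 0 \<Longrightarrow> b * a = c \<longleftrightarrow> b = c * inverse a"
  using inverse_mult_cancel_right mult_inverse_cancel_right by auto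

lemma alt_mult_eq_0: "a * b = 0 \<longleftrightarrow> a = 0 \<or> b = 0"
  using alt_mult_eq_left[of a b 0] by (auto simp: alt_mult_zero)

end

text \<open>\<open>Graph m b\<close> is the line \<open>y = m x + b\<close> and \<open>Column c\<close> the line \<open>x = c\<close>; the ideal line
  consists of the points \<open>Slope m\<close> and \<open>Vertical\<close>.\<close>

datatype 'a point = Affine 'a 'a | Slope 'a | Vertical

datatype 'a line = Graph 'a 'a | Column 'a | Ideal

fun on_line :: "'a::alternative_division_ring point \<Rightarrow> 'a line \<Rightarrow> bool" where
  "on_line (Affine x y) (Graph m b) \<longleftrightarrow> y = m * x + b"
| "on_line (Affine x y) (Column c) \<longleftrightarrow> x = c"
| "on_line (Affine x y) Ideal \<longleftrightarrow> False"
| "on_line (Slope n) (Graph m b) \<longleftrightarrow> n = m"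
| "on_line (Slope n) (Column c) \<longleftrightarrow> False"
| "on_line (Slope n) Ideal \<longleftrightarrow> True"
| "on_line Vertical (Graph m b) \<longleftrightarrow> False"
| "on_line Vertical (Column c) \<longleftrightarrow> True"
| "on_line Vertical Ideal \<longleftrightarrow> True"

definition coordinate_plane :: "('a::alternative_division_ring point, 'a line) plane" where
  "coordinate_plane = \<lparr>Pts = UNIV, Lns = UNIV, Inc = on_line\<rparr>"

lemma coordinate_plane_simps [simp]:
  "Pts coordinate_plane = UNIV" "Lns coordinate_plane = UNIV" "Inc coordinate_plane = on_line"
  by (simp_all add: coordinate_plane_def)

section \<open>Projective plane axioms in coordinates\<close>

lemma ex_line_on: "\<exists>l. on_line A l \<and> on_line B l"
proof -
  have aff: "\<exists>l. on_line (Affine x y) l \<and> on_line (Affine x' y') l" for x y x' y' :: 'a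
  proof (cases "x = x'")
    case True
    then show ?thesis by (intro exI[of _ "Column x"]) simp
  next
    case False
    \<comment> \<open>Slopes multiply from the left, so the difference quotient divides on the
      right.\<close>
    define m where "m = (y - y') * inverse (x - x')"
    have "m * (x - x') = y - y'"
      unfolding m_def using False by (simp add: mult_inverse_cancel_right)
    then show ?thesis
      by (intro exI[of _ "Graph m (y - m * x)"]) (simp add: alt_right_diff_distrib algebra_simps)
  qed
  have slope: "\<exists>l. on_line (Affine x y) l \<and> on_line (Slope m) l" for x y m :: 'a
    by (rule exI[of _ "Graph m (y - m * x)"]) simp
  have vert: "\<exists>l. on_line (Affine x y) l \<and> on_line Vertical l" for x y :: 'a
    by (rule exI[of _ "Column x"]) simp
  have ideal: "\<exists>l. on_line A l \<and> on_line B l" if "on_line A Ideal" "on_line B Ideal" for A B :: "'a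
    point"
    using that by blast
  show ?thesis
    using aff slope vert ideal by (cases A; cases B) (auto, metis+)
qed

lemma ex_point_on: "\<exists>A. on_line A m \<and> on_line A n"
proof -
  have graphs: "\<exists>A. on_line A (Graph s b) \<and> on_line A (Graph t c)" for s b t c :: 'a
  proof (cases "s = t")
    case True
    then show ?thesis by (intro exI[of _ "Slope s"]) simp
  next
    case False
    \<comment> \<open>Dually, the abscissa solves \<open>(s - t) x = c - b\<close>, which calls for
      division on the left.\<close>
    define x where "x = inverse (s - t) * (c - b)"
    have "(s - t) * x = c - b"
      unfolding x_def using False by (simp add: mult_inverse_cancel_left)
    then show ?thesis
      by (intro exI[of _ "Affine x (s * x + b)"]) (simp add: alt_left_diff_distrib algebra_simps)
  qed
  have column: "\<exists>A. on_line A (Graph s b) \<and> on_line A (Column c)" for s b c :: 'a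
    by (rule exI[of _ "Affine c (s * c + b)"]) simp
  have vert: "\<exists>A. on_line A (Graph s b) \<and> on_line A Ideal" for s b :: 'a
    by (rule exI[of _ "Slope s"]) simp
  have ideal: "\<exists>A. on_line A m \<and> on_line A n" if "on_line Vertical m" "on_line Vertical n" for m n
    :: "'a line"
    using that by blast
  show ?thesis
    using graphs column vert ideal by (cases m; cases n) (auto, metis+)
qed

text \<open>Two graphs with two common affine points give \<open>(s - t) (x - x') = 0\<close> by
  both distributive laws, and there are no zero divisors. All other cases are immediate.\<close>

lemma on_line_unique:
  assumes "on_line A m" "on_line A n" "on_line B m" "on_line B n"
  shows "A = B \<or> m = n"
proof -
  have graphs: "x = x' \<or> s = t"
    if "s * x + b = t * x + c" "s * x' + b = t * x' + c" for x x' s b t c :: 'a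
  proof -
    have "(s - t) * (x - x') = (s * x + b - (t * x + c)) - (s * x' + b - (t * x' + c))"
      by (simp add: alt_left_diff_distrib alt_right_diff_distrib algebra_simps)
    then show ?thesis using that by (auto simp: alt_mult_eq_0)
  qed
  show ?thesis
  proof (cases m; cases n)
    fix s b t c assume mn: "m = Graph s b" "n = Graph t c"
    show ?thesis
    proof (cases A; cases B)
      fix x y x' y' assume AB: "A = Affine x y" "B = Affine x' y'"
      then show ?thesis
        using assms mn graphs[of s x b t c x'] by auto
    qed (use assms mn in auto)
  qed (use assms in \<open>cases A; cases B; auto\<close>)+
qed

lemma projective_coordinate_plane:
  "projective_plane (coordinate_plane :: ('a::alternative_division_ring point, 'a line) plane)"
  (is "projective_plane ?S")
proof (rule projective_planeI)
  \<comment> \<open>The origin, the unit point and the ideal points of the two axes.\<close>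
  let ?X = "{Affine 0 0, Affine 1 1, Slope 0, Vertical} :: 'a point set"
  have "\<not> collinear ?S Y" if Y: "Y \<subseteq> ?X" "card Y = 3" for Y
  proof
    assume "collinear ?S Y"
    then obtain l where l: "\<And>A. A \<in> Y \<Longrightarrow> on_line A l"
      unfolding collinear_def by auto
    \<comment> \<open>A three-element subset omits exactly one point of the quadrangle, so only the
      four choices of that point need testing.\<close>
    have "card (?X - Y) = 1"
      using Y by (subst card_Diff_subset) (auto intro: finite_subset)
    then obtain A where "?X - Y = {A}"
      by (rule card_1_singletonE)
    then have A: "A \<in> ?X" and on: "\<And>B. B \<in> ?X \<Longrightarrow> B \<noteq> A \<Longrightarrow> on_line B l"
      using l by auto
    show False
      using A on[of "Affine 0 0"] on[of "Affine 1 1"] on[of "Slope 0"] on[of Vertical]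
      by (cases l) (auto simp: alt_mult_zero)
  qed
  then show "\<exists>X\<subseteq>Pts ?S. card X = 4 \<and> (\<forall>Y\<subseteq>X. card Y = 3 \<longrightarrow> \<not> collinear ?S Y)"
    by (intro exI[of _ ?X]) auto
qed (simp_all add: ex_line_on ex_point_on, rule on_line_unique)

section \<open>Collineations of the coordinate plane\<close>

lemma plane_iso_coordinate_plane:
  assumes "bij f" "bij g" "\<And>A l. on_line (f A) (g l) \<longleftrightarrow> on_line A l"
  shows "plane_iso coordinate_plane coordinate_plane f g"
  using assms by (simp add: plane_iso_def)

context
  fixes s p q :: "'a::alternative_division_ring"
begin

text \<open>The collineation induced by \<open>(x, y) \<mapsto> (x + p, y + s x + q)\<close>.\<close>

fun shear_point :: "'a point \<Rightarrow> 'a point" where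
  "shear_point (Affine x y) = Affine (x + p) (y + s * x + q)"
| "shear_point (Slope m) = Slope (m + s)"
| "shear_point Vertical = Vertical"

text \<open>The new intercept comes from substituting \<open>x - p\<close> for \<open>x\<close> in
  \<open>(m + s) x + b + q\<close>.\<close>

fun shear_line :: "'a line \<Rightarrow> 'a line" where
  "shear_line (Graph m b) = Graph (m + s) (b + q - (m + s) * p)"
| "shear_line (Column c) = Column (c + p)"
| "shear_line Ideal = Ideal"

lemma bij_shear_point: "bij shear_point"
proof (rule o_bij)
  let ?g = "\<lambda>A. case A of Affine x y \<Rightarrow> Affine (x - p) (y - s * (x - p) - q)
    | Slope m \<Rightarrow> Slope (m - s) | Vertical \<Rightarrow> Vertical"
  show "?g \<circ> shear_point = id" "shear_point \<circ> ?g = id"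
    by (auto simp: fun_eq_iff split: point.split elim: shear_point.elims)
qed

lemma bij_shear_line: "bij shear_line"
proof (rule o_bij)
  let ?g = "\<lambda>l. case l of Graph m b \<Rightarrow> Graph (m - s) (b - q + m * p)
    | Column c \<Rightarrow> Column (c - p) | Ideal \<Rightarrow> Ideal"
  show "?g \<circ> shear_line = id" "shear_line \<circ> ?g = id"
    by (auto simp: fun_eq_iff algebra_simps split: line.split elim: shear_line.elims)
qed

lemma on_line_shear: "on_line (shear_point A) (shear_line l) \<longleftrightarrow> on_line A l"
  by (cases A; cases l) (simp_all add: alt_distrib_left alt_distrib_right algebra_simps)

lemmas plane_iso_shear = plane_iso_coordinate_plane[OF bij_shear_point bij_shear_line on_line_shear]

end

text \<open>The collineation induced by \<open>(x, y) \<mapsto> (y, x)\<close>.\<close>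

fun flip_point :: "'a::alternative_division_ring point \<Rightarrow> 'a point" where
  "flip_point (Affine x y) = Affine y x"
| "flip_point (Slope m) = (if m = 0 then Vertical else Slope (inverse m))"
| "flip_point Vertical = Slope 0"

fun flip_line :: "'a::alternative_division_ring line \<Rightarrow> 'a line" where
  "flip_line (Graph m b) = (if m = 0 then Column b else Graph (inverse m) (- (inverse m * b)))"
| "flip_line (Column c) = Graph 0 c"
| "flip_line Ideal = Ideal"

text \<open>By the left inverse law, \<open>y = m x + b\<close> solves to
  \<open>x = (1/m) y - (1/m) b\<close> for nonzero \<open>m\<close>. Both maps are involutions,
  hence bijective.\<close>

lemma plane_iso_flip: "plane_iso coordinate_plane coordinate_plane flip_point flip_line"
proof (rule plane_iso_coordinate_plane)
  have "flip_point (flip_point A) = A" for A :: "'a point"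
    by (cases A) (auto simp: alt_inverse_inverse alt_inverse_nonzero)
  then show "bij (flip_point :: 'a point \<Rightarrow> _)" by (rule involuntory_imp_bij)
  have "flip_line (flip_line l) = l" for l :: "'a line"
    by (cases l) (auto simp: alt_inverse_inverse alt_inverse_nonzero alt_mult_minus
      mult_inverse_cancel_left)
  then show "bij (flip_line :: 'a line \<Rightarrow> _)" by (rule involuntory_imp_bij)
next
  fix A l
  have "x = inverse m * y - inverse m * b \<longleftrightarrow> y = m * x + b" if "m \<noteq> 0" for x y m b :: 'a
    using alt_mult_eq_left[OF that, of x "y - b"] by (auto simp: alt_right_diff_distrib algebra_simps)
  moreover have "inverse m = inverse n \<longleftrightarrow> m = n" if "m \<noteq> 0" "n \<noteq> 0" for m n :: 'a
    using that alt_inverse_inverse by metis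
  ultimately show "on_line (flip_point A) (flip_line l) \<longleftrightarrow> on_line A (l :: 'a line)"
    by (cases A; cases l) (auto simp: alt_mult_zero alt_inverse_nonzero)
qed

text \<open>The collineation induced by \<open>(x, y) \<mapsto> (1/x, y/x)\<close>.\<close>

fun swap_point :: "'a::alternative_division_ring point \<Rightarrow> 'a point" where
  "swap_point (Affine x y) = (if x = 0 then Slope y else Affine (inverse x) (y * inverse x))"
| "swap_point (Slope m) = Affine 0 m"
| "swap_point Vertical = Vertical"

fun swap_line :: "'a::alternative_division_ring line \<Rightarrow> 'a line" where
  "swap_line (Graph m b) = Graph b m"
| "swap_line (Column c) = (if c = 0 then Ideal else Column (inverse c))"
| "swap_line Ideal = Column 0"

text \<open>Multiplying \<open>y = m x + b\<close> on the right by \<open>1/x\<close> gives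
  \<open>y (1/x) = b (1/x) + m\<close> by the right inverse law, so slope and intercept trade
  places, as do the column \<open>x = 0\<close> and the ideal line.\<close>

lemma plane_iso_swap: "plane_iso coordinate_plane coordinate_plane swap_point swap_line"
proof (rule plane_iso_coordinate_plane)
  have "swap_point (swap_point A) = A" for A :: "'a point"
    by (cases A) (auto simp: alt_inverse_inverse alt_inverse_nonzero mult_inverse_cancel_right)
  then show "bij (swap_point :: 'a point \<Rightarrow> _)" by (rule involuntory_imp_bij)
  have "swap_line (swap_line l) = l" for l :: "'a line"
    by (cases l) (auto simp: alt_inverse_inverse alt_inverse_nonzero)
  then show "bij (swap_line :: 'a line \<Rightarrow> _)" by (rule involuntory_imp_bij)
next
  fix A l
  have "y * inverse x = b * inverse x + m \<longleftrightarrow> y = m * x + b" if "x \<noteq> 0" for x y m b :: 'a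
    using alt_mult_eq_right[OF that, of m "y - b"] by (auto simp: alt_left_diff_distrib algebra_simps)
  moreover have "inverse m = inverse n \<longleftrightarrow> m = n" if "m \<noteq> 0" "n \<noteq> 0" for m n :: 'a
    using that alt_inverse_inverse by metis
  ultimately show "on_line (swap_point A) (swap_line l) \<longleftrightarrow> on_line A (l :: 'a line)"
    by (cases A; cases l) (auto simp: alt_mult_zero alt_inverse_nonzero)
qed

section \<open>Elation transitivity for every flag of the coordinate plane\<close>

lemma elation_transitive_coordinate_plane_iso:
  assumes "plane_iso coordinate_plane coordinate_plane f g" "elation_transitive coordinate_plane (f
    P) (g l)"
  shows "elation_transitive coordinate_plane P l"
proof -
  have "inv f (f P) = P" "inv g (g l) = l"
    using plane_iso_bij(3,4)[OF assms(1)] by simp_all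
  then show ?thesis
    using elation_transitive_iso[OF plane_iso_inv[OF assms(1)] _ _ assms(2)] by simp
qed

lemma elation_transitive_Vertical_Ideal:
  "elation_transitive (coordinate_plane :: ('a::alternative_division_ring point, 'a line) plane)
    Vertical Ideal"
  unfolding elation_transitive_def
proof (intro ballI impI)
  fix A B :: "'a point"
  assume "\<not> Inc coordinate_plane A Ideal" "\<not> Inc coordinate_plane B Ideal"
    and "collinear coordinate_plane {Vertical, A, B}"
  \<comment> \<open>Affine points collinear with \<open>Vertical\<close> share a column, so the
    vertical translation by \<open>z - y\<close> carries one to the other.\<close>
  then obtain x y z where AB: "A = Affine x y" "B = Affine x z"
    unfolding collinear_def by (cases A; cases B) (auto elim!: on_line.elims)
  show "\<exists>f g. plane_iso coordinate_plane coordinate_plane f g \<and> f A = B \<and>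
      (\<forall>X\<in>Pts coordinate_plane. Inc coordinate_plane X Ideal \<longrightarrow> f X = X) \<and>
      (\<forall>m\<in>Lns coordinate_plane. Inc coordinate_plane Vertical m \<longrightarrow> g m = m)"
  proof (intro exI conjI ballI impI)
    show "plane_iso coordinate_plane coordinate_plane (shear_point 0 0 (z - y)) (shear_line 0 0 (z
      - y))"
      by (rule plane_iso_shear)
    show "shear_point 0 0 (z - y) A = B"
      by (simp add: AB alt_mult_zero)
    show "shear_point 0 0 (z - y) X = X" if "Inc coordinate_plane X Ideal" for X
      using that by (cases X) auto
    show "shear_line 0 0 (z - y) m = m" if "Inc coordinate_plane Vertical m" for m
      using that by (cases m) auto
  qed
qed

text \<open>A chain of reductions: graphs to columns, columns to the ideal line, and ideal points to
  \<open>Vertical\<close>.\<close>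

lemma elation_transitive_coordinate_plane:
  fixes P :: "'a::alternative_division_ring point"
  assumes "on_line P l"
  shows "elation_transitive coordinate_plane P l"
proof -
  note reduce = elation_transitive_coordinate_plane_iso
  have ideal: "elation_transitive coordinate_plane P Ideal" if "on_line P Ideal" for P :: "'a point"
  proof (cases P)
    case (Slope m)
    \<comment> \<open>The shear brings slope \<open>m\<close> to \<open>0\<close>; the flip then
      turns \<open>Slope 0\<close> into \<open>Vertical\<close> and keeps the ideal line.\<close>
    show ?thesis
      by (rule reduce[OF plane_iso_shear[of "- m" 0 0]], rule reduce[OF plane_iso_flip])
        (simp add: Slope elation_transitive_Vertical_Ideal)
  qed (use that elation_transitive_Vertical_Ideal in auto)
  \<comment> \<open>Translating to \<open>x = 0\<close> and swapping sends the column to the ideal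
    line; the image of \<open>P\<close> lies on it because collineations preserve incidence.\<close>
  have column: "elation_transitive coordinate_plane P (Column c)" if P: "on_line P (Column c)"
    for P :: "'a point" and c
  proof (rule reduce[OF plane_iso_shear[of 0 "- c" 0]], rule reduce[OF plane_iso_swap])
    have "on_line (swap_point (shear_point 0 (- c) 0 P)) (swap_line (shear_line 0 (- c) 0 (Column c)))"
      using P by (simp add: on_line_shear plane_iso_Inc[OF plane_iso_swap, simplified]
          del: shear_line.simps swap_line.simps)
    then show "elation_transitive coordinate_plane (swap_point (shear_point 0 (- c) 0 P))
        (swap_line (shear_line 0 (- c) 0 (Column c)))"
      using ideal by simp
  qed
  show ?thesis
  proof (cases l)
    \<comment> \<open>The shear makes the line horizontal and the flip turns it into a
      column.\<close>
    case (Graph m b)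
    let ?P = "flip_point (shear_point (- m) 0 0 P)" and ?l = "flip_line (shear_line (- m) 0 0 l)"
    show ?thesis
    proof (rule reduce[OF plane_iso_shear[of "- m" 0 0]], rule reduce[OF plane_iso_flip])
      have "on_line ?P ?l"
        using assms by (simp add: on_line_shear plane_iso_Inc[OF plane_iso_flip, simplified])
      moreover have "?l = Column b"
        by (simp add: Graph alt_mult_zero)
      ultimately show "elation_transitive coordinate_plane ?P ?l"
        using column by simp
    qed
  qed (use assms ideal column in auto)
qed

section \<open>The octonion plane\<close>

datatype octonion = Octonion (oc0: real) (oc1: real) (oc2: real) (oc3: real)
  (oc4: real) (oc5: real) (oc6: real) (oc7: real)

instantiation octonion :: "{ab_group_add, zero_neq_one, times, inverse}"
begin

definition "0 = Octonion 0 0 0 0 0 0 0 0"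
definition "1 = Octonion 1 0 0 0 0 0 0 0"
definition "x + y = Octonion (oc0 x + oc0 y) (oc1 x + oc1 y) (oc2 x + oc2 y) (oc3 x + oc3 y)
  (oc4 x + oc4 y) (oc5 x + oc5 y) (oc6 x + oc6 y) (oc7 x + oc7 y)"
definition "- x = Octonion (- oc0 x) (- oc1 x) (- oc2 x) (- oc3 x)
  (- oc4 x) (- oc5 x) (- oc6 x) (- oc7 x)"
definition "x - y = x + (- y :: octonion)"

text \<open>Cayley-Dickson doubling of the quaternions \<open>e0, ..., e3\<close> with new unit
  \<open>e4\<close>: \<open>(p, q) (r, s) = (p r - cnj(s) q, s p + q cnj(r))\<close>.\<close>

definition
  "x * y = Octonion
      (oc0 x * oc0 y - oc1 x * oc1 y - oc2 x * oc2 y - oc3 x * oc3 y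
       - oc4 x * oc4 y - oc5 x * oc5 y - oc6 x * oc6 y - oc7 x * oc7 y)
      (oc0 x * oc1 y + oc1 x * oc0 y + oc2 x * oc3 y - oc3 x * oc2 y
       + oc4 x * oc5 y - oc5 x * oc4 y - oc6 x * oc7 y + oc7 x * oc6 y)
      (oc0 x * oc2 y - oc1 x * oc3 y + oc2 x * oc0 y + oc3 x * oc1 y
       + oc4 x * oc6 y + oc5 x * oc7 y - oc6 x * oc4 y - oc7 x * oc5 y)
      (oc0 x * oc3 y + oc1 x * oc2 y - oc2 x * oc1 y + oc3 x * oc0 y
       + oc4 x * oc7 y - oc5 x * oc6 y + oc6 x * oc5 y - oc7 x * oc4 y)
      (oc0 x * oc4 y - oc1 x * oc5 y - oc2 x * oc6 y - oc3 x * oc7 y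
       + oc4 x * oc0 y + oc5 x * oc1 y + oc6 x * oc2 y + oc7 x * oc3 y)
      (oc0 x * oc5 y + oc1 x * oc4 y - oc2 x * oc7 y + oc3 x * oc6 y
       - oc4 x * oc1 y + oc5 x * oc0 y - oc6 x * oc3 y + oc7 x * oc2 y)
      (oc0 x * oc6 y + oc1 x * oc7 y + oc2 x * oc4 y - oc3 x * oc5 y
       - oc4 x * oc2 y + oc5 x * oc3 y + oc6 x * oc0 y - oc7 x * oc1 y)
      (oc0 x * oc7 y - oc1 x * oc6 y + oc2 x * oc5 y + oc3 x * oc4 y
       - oc4 x * oc3 y - oc5 x * oc2 y + oc6 x * oc1 y + oc7 x * oc0 y)"

definition octonion_norm2 :: "octonion \<Rightarrow> real" where
  "octonion_norm2 x = (oc0 x)^2 + (oc1 x)^2 + (oc2 x)^2 + (oc3 x)^2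
     + (oc4 x)^2 + (oc5 x)^2 + (oc6 x)^2 + (oc7 x)^2"

definition
  "inverse x = Octonion (oc0 x / octonion_norm2 x) (- oc1 x / octonion_norm2 x)
     (- oc2 x / octonion_norm2 x) (- oc3 x / octonion_norm2 x) (- oc4 x / octonion_norm2 x)
     (- oc5 x / octonion_norm2 x) (- oc6 x / octonion_norm2 x) (- oc7 x / octonion_norm2 x)"

definition "x div y = x * inverse (y :: octonion)"

instance
  by standard
    (simp_all add: zero_octonion_def one_octonion_def plus_octonion_def uminus_octonion_def
      minus_octonion_def octonion.expand)

end

lemmas octonion_arith = zero_octonion_def one_octonion_def plus_octonion_def uminus_octonion_def
  minus_octonion_def times_octonion_def

definition octonion_scale :: "real \<Rightarrow> octonion \<Rightarrow> octonion" where
  "octonion_scale r x = Octonion (r * oc0 x) (r * oc1 x) (r * oc2 x) (r * oc3 x)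
     (r * oc4 x) (r * oc5 x) (r * oc6 x) (r * oc7 x)"

definition octonion_cnj :: "octonion \<Rightarrow> octonion" where
  "octonion_cnj x = Octonion (oc0 x) (- oc1 x) (- oc2 x) (- oc3 x) (- oc4 x) (- oc5 x)
     (- oc6 x) (- oc7 x)"

lemma inverse_octonion_eq: "inverse x = octonion_scale (1 / octonion_norm2 x) (octonion_cnj x)"
  by (simp add: inverse_octonion_def octonion_scale_def octonion_cnj_def)

lemma octonion_scale_mult:
  "octonion_scale r x * y = octonion_scale r (x * y)"
  "x * octonion_scale r y = octonion_scale r (x * y)"
  by (simp_all add: octonion_scale_def times_octonion_def algebra_simps)

text \<open>Alternativity in the form that yields the inverse laws after division by the norm. Each
  component is a polynomial identity in sixteen real variables.\<close>

lemma octonion_cnj_mult_cancel_left: "octonion_cnj x * (x * y) = octonion_scale (octonion_norm2 x) y"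
  unfolding octonion_cnj_def octonion_scale_def octonion_norm2_def times_octonion_def
  by (intro octonion.expand) (simp only: octonion.sel simp_thms, intro conjI; algebra)

lemma octonion_cnj_mult_cancel_right: "(y * x) * octonion_cnj x = octonion_scale (octonion_norm2 x) y"
  unfolding octonion_cnj_def octonion_scale_def octonion_norm2_def times_octonion_def
  by (intro octonion.expand) (simp only: octonion.sel simp_thms, intro conjI; algebra)

lemma octonion_norm2_nonzero: "x \<noteq> 0 \<Longrightarrow> octonion_norm2 x \<noteq> 0"
  by (cases x) (auto simp: octonion_norm2_def zero_octonion_def add_nonneg_eq_0_iff)

lemma octonion_scale_inverse:
  "r \<noteq> 0 \<Longrightarrow> octonion_scale (1 / r) (octonion_scale r x) = x"
  by (simp add: octonion_scale_def)

instance octonion :: alternative_division_ring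
proof
  fix a b c :: octonion
  show "a * (b + c) = a * b + a * c" "(a + b) * c = a * c + b * c"
    by (simp_all add: times_octonion_def plus_octonion_def algebra_simps)
  show "1 * a = a" "a * 1 = a"
    by (simp_all add: times_octonion_def one_octonion_def)
  show "inverse a * (a * b) = b" "(b * a) * inverse a = b" if "a \<noteq> 0"
    by (simp_all add: inverse_octonion_eq octonion_scale_mult octonion_cnj_mult_cancel_left
        octonion_cnj_mult_cancel_right octonion_scale_inverse octonion_norm2_nonzero[OF that])
qed

section \<open>A copy of the octonion plane on lists of reals\<close>

fun octonion_coords :: "octonion \<Rightarrow> real list" where
  "octonion_coords (Octonion x0 x1 x2 x3 x4 x5 x6 x7) = [x0, x1, x2, x3, x4, x5, x6, x7]"

lemma length_octonion_coords [simp]: "length (octonion_coords x) = 8"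
  by (cases x) simp

lemma octonion_coords_inject [simp]: "octonion_coords x = octonion_coords y \<longleftrightarrow> x = y"
  by (cases x; cases y) simp

lemma octonion_coords_append:
  "octonion_coords x \<noteq> []" "octonion_coords x @ octonion_coords y \<noteq> octonion_coords z"
  by (cases x; simp) (cases x; cases y; cases z; simp)

text \<open>The three kinds of point become lists of length 16, 8 and 0, so they cannot be confused;
  lines are treated alike.\<close>

fun encode_point :: "octonion point \<Rightarrow> real list" where
  "encode_point (Affine x y) = octonion_coords x @ octonion_coords y"
| "encode_point (Slope m) = octonion_coords m"
| "encode_point Vertical = []"

fun encode_line :: "octonion line \<Rightarrow> real list" where
  "encode_line (Graph m b) = octonion_coords m @ octonion_coords b"
| "encode_line (Column c) = octonion_coords c"
| "encode_line Ideal = []"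

lemma inj_encode_point: "inj encode_point"
proof (rule injI)
  fix A B assume "encode_point A = encode_point B"
  then show "A = B" by (cases A; cases B)
      (simp_all add: octonion_coords_append octonion_coords_append[THEN not_sym])
qed

lemma inj_encode_line: "inj encode_line"
proof (rule injI)
  fix l m assume "encode_line l = encode_line m"
  then show "l = m" by (cases l; cases m)
      (simp_all add: octonion_coords_append octonion_coords_append[THEN not_sym])
qed

declare encode_point.simps [simp del] encode_line.simps [simp del]

definition octonion_plane :: "(real list, real list) plane" where
  "octonion_plane = \<lparr>Pts = range encode_point, Lns = range encode_line,
     Inc = (\<lambda>A l. on_line (inv encode_point A) (inv encode_line l))\<rparr>"

lemma octonion_plane_simps [simp]:
  "Pts octonion_plane = range encode_point" "Lns octonion_plane = range encode_line"
  "Inc octonion_plane (encode_point A) (encode_line l) \<longleftrightarrow> on_line A l"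
  by (simp_all add: octonion_plane_def inj_encode_point inj_encode_line)

lemma plane_iso_octonion_plane: "plane_iso coordinate_plane octonion_plane encode_point encode_line"
  by (simp add: plane_iso_def bij_betw_def inj_encode_point inj_encode_line)

lemma projective_octonion_plane: "projective_plane octonion_plane"
  using projective_plane_iso[OF plane_iso_octonion_plane projective_coordinate_plane] .

lemma moufang_octonion_plane: "moufang_plane octonion_plane"
  unfolding moufang_plane_def
proof (intro conjI little_desargues_if_elation_transitive projective_octonion_plane)
  fix P l
  assume "P \<in> Pts octonion_plane" "l \<in> Lns octonion_plane" "Inc octonion_plane P l"
  then obtain A m where "P = encode_point A" "l = encode_line m" "on_line A m"
    by auto
  then show "elation_transitive octonion_plane P l"
    using elation_transitive_iso[OF plane_iso_octonion_plane _ _ elation_transitive_coordinate_plane]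
    by simp
qed

section \<open>Failure of the converse Bricard property\<close>

lemma join_octonion_plane:
  assumes "A \<noteq> B" "on_line A l" "on_line B l"
  shows "join octonion_plane (encode_point A) (encode_point B) = encode_line l"
  using assms inj_eq[OF inj_encode_point]
  by (intro proj_plane.join_eq[OF proj_plane.intro[OF projective_octonion_plane]]) auto

lemma meet_octonion_plane:
  assumes "l \<noteq> m" "on_line A l" "on_line A m"
  shows "meet octonion_plane (encode_line l) (encode_line m) = encode_point A"
  using assms inj_eq[OF inj_encode_line]
  by (intro proj_plane.meet_eq[OF proj_plane.intro[OF projective_octonion_plane]]) auto

text \<open>As \<open>A\<close> and \<open>B\<close> differ, \<open>l\<close> is the only candidate
  for a line through all three.\<close>

lemma triangle_octonion_plane:
  assumes "A \<noteq> B" "on_line A l" "on_line B l" "\<not> on_line C l"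
  shows "triangle octonion_plane (encode_point A) (encode_point B) (encode_point C)"
proof -
  have "\<not> (on_line A m \<and> on_line B m \<and> on_line C m)" for m
    using assms on_line_unique[of A m l B] by auto
  then show ?thesis
    by (auto simp: triangle_def collinear_def)
qed

lemma not_converse_bricard_octonion_plane: "\<not> converse_bricard octonion_plane"
proof
  let ?A = "Slope 0 :: octonion point"
  let ?B = "Vertical :: octonion point"
  let ?C = "Affine 0 0 :: octonion point"
  \<comment> \<open>A', B', C' lie on \<open>y = 1\<close>, \<open>x = 1\<close> and
    \<open>y = - x\<close>. These lines alone determine D, E, F, so the collinearity premise holds
    for every choice of a, b, c.\<close>
  let ?A1 = "Affine (Octonion 1 1 0 0 0 0 0 0) 1 :: octonion point"
  let ?B1 = "Affine 1 (Octonion 0 0 (- 1) 0 0 0 0 0) :: octonion point"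
  let ?C1 = "Affine (Octonion 1 0 0 0 1 0 0 0) (Octonion (- 1) 0 0 0 (- 1) 0 0 0) :: octonion point"
  \<comment> \<open>P is the intercept of B'C', Q the zero of A'C' and R the slope of A'B'; slopes
    are quotients \<open>(y - y') (1/(x - x'))\<close>.\<close>
  let ?P = "Affine 0 (Octonion 1 0 (- 1) 0 (- 1) 0 1 0) :: octonion point"
  let ?Q = "Affine (Octonion (6/5) (3/5) 0 0 (2/5) (1/5) 0 0) 0 :: octonion point"
  let ?R = "Slope (Octonion 0 (- 1) 0 1 0 0 0 0) :: octonion point"
  let ?D = "Affine 0 1 :: octonion point"
  let ?E = "Affine 1 0 :: octonion point"
  let ?F = "Slope (- 1) :: octonion point"
  \<comment> \<open>The common point of B'Q and C'R.\<close>
  let ?X = "Affine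
    (Octonion (7/5) 1 (2/5) 0 1 (3/5) (2/5) (- 2/5))
    (Octonion 0 (- 4/5) 1 0 0 (2/5) (- 1/5) (2/5)) :: octonion point"
  let ?lBC = "Column 0 :: octonion line"
  let ?lAC = "Graph 0 0 :: octonion line"
  let ?lAB = "Ideal :: octonion line"
  let ?lBC1 = "Graph
    (Octonion (- 1) 0 0 0 1 0 (- 1) 0)
    (Octonion 1 0 (- 1) 0 (- 1) 0 1 0) :: octonion line"
  let ?lAC1 = "Graph
    (Octonion (- 1/2) (- 1) 0 0 1 (1/2) 0 0)
    (Octonion (1/2) (3/2) 0 0 (- 3/2) (1/2) 0 0) :: octonion line"
  let ?lAB1 = "Graph (Octonion 0 (- 1) 0 1 0 0 0 0) (Octonion 0 1 (- 1) (- 1) 0 0 0 0) :: octonion line"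
  let ?lAA = "Graph 0 1 :: octonion line"
  let ?lBB = "Column 1 :: octonion line"
  let ?lCC = "Graph (- 1) 0 :: octonion line"
  let ?lDEF = "Graph (- 1) 1 :: octonion line"
  let ?lAP = "Graph
    (Octonion 0 0 (1/2) (1/2) (1/2) (1/2) (- 1/2) (1/2))
    (Octonion 1 0 (- 1) 0 (- 1) 0 1 0) :: octonion line"
  let ?lBQ = "Graph
    (Octonion 0 0 (1/3) 1 0 0 (- 2/3) (- 1/3))
    (Octonion 0 0 (- 4/3) (- 1) 0 0 (2/3) (1/3)) :: octonion line"
  let ?lCR = "Graph
    (Octonion 0 (- 1) 0 1 0 0 0 0)
    (Octonion (- 1) 1 0 (- 1) (- 1) 1 0 (- 1)) :: octonion line"
  note point_eq = inj_eq[OF inj_encode_point] and line_eq = inj_eq[OF inj_encode_line]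
  have joins:
    "join octonion_plane (encode_point ?B) (encode_point ?C) = encode_line ?lBC"
    "join octonion_plane (encode_point ?A) (encode_point ?C) = encode_line ?lAC"
    "join octonion_plane (encode_point ?A) (encode_point ?B) = encode_line ?lAB"
    "join octonion_plane (encode_point ?B1) (encode_point ?C1) = encode_line ?lBC1"
    "join octonion_plane (encode_point ?A1) (encode_point ?C1) = encode_line ?lAC1"
    "join octonion_plane (encode_point ?A1) (encode_point ?B1) = encode_line ?lAB1"
    "join octonion_plane (encode_point ?A) (encode_point ?A1) = encode_line ?lAA"
    "join octonion_plane (encode_point ?B) (encode_point ?B1) = encode_line ?lBB"
    "join octonion_plane (encode_point ?C) (encode_point ?C1) = encode_line ?lCC"
    "join octonion_plane (encode_point ?A1) (encode_point ?P) = encode_line ?lAP"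
    "join octonion_plane (encode_point ?B1) (encode_point ?Q) = encode_line ?lBQ"
    "join octonion_plane (encode_point ?C1) (encode_point ?R) = encode_line ?lCR"
    by (rule join_octonion_plane; simp add: octonion_arith)+
  have meets:
    "meet octonion_plane (encode_line ?lBC) (encode_line ?lBC1) = (encode_point ?P)"
    "meet octonion_plane (encode_line ?lAC) (encode_line ?lAC1) = (encode_point ?Q)"
    "meet octonion_plane (encode_line ?lAB) (encode_line ?lAB1) = (encode_point ?R)"
    "meet octonion_plane (encode_line ?lBC) (encode_line ?lAA) = (encode_point ?D)"
    "meet octonion_plane (encode_line ?lAC) (encode_line ?lBB) = (encode_point ?E)"
    "meet octonion_plane (encode_line ?lAB) (encode_line ?lCC) = (encode_point ?F)"
    by (rule meet_octonion_plane; simp add: octonion_arith)+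
  have tri: "triangle octonion_plane (encode_point ?A) (encode_point ?B) (encode_point ?C)"
    by (rule triangle_octonion_plane[of _ _ ?lAB]) simp_all
  have tri': "triangle octonion_plane (encode_point ?A1) (encode_point ?B1) (encode_point ?C1)"
    by (rule triangle_octonion_plane[of _ _ ?lAB1]; simp add: octonion_arith)
  have placed: "well_placed octonion_plane (encode_point ?A) (encode_point ?B) (encode_point ?C)
    (encode_point ?A1) (encode_point ?B1) (encode_point ?C1)"
    unfolding well_placed_def joins by (simp add: point_eq line_eq octonion_arith)
  have coll: "collinear octonion_plane {(encode_point ?D), (encode_point ?E), (encode_point ?F)}"
    unfolding collinear_def
    by (rule bexI[of _ "encode_line ?lDEF"]) (simp_all add: octonion_arith)
  have not_conc: "\<not> concurrent octonion_plane {encode_line ?lAP, encode_line ?lBQ, encode_line ?lCR}"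
  proof
    assume "concurrent octonion_plane {encode_line ?lAP, encode_line ?lBQ, encode_line ?lCR}"
    then obtain Y where Y: "on_line Y ?lAP" "on_line Y ?lBQ" "on_line Y ?lCR"
      unfolding concurrent_def by auto
    \<comment> \<open>Two of the lines already determine the common point, so it remains to test the
      third at \<open>?X\<close>.\<close>
    have "on_line ?X ?lBQ" "on_line ?X ?lCR" "?lBQ \<noteq> ?lCR"
      by (simp_all add: octonion_arith)
    then have "Y = ?X"
      using on_line_unique[of Y ?lBQ ?lCR ?X] Y by blast
    \<comment> \<open>Slope times abscissa plus intercept for \<open>?lAP\<close> has real part
      \<open>2/5\<close> at \<open>?X\<close>, whereas the ordinate of \<open>?X\<close> has real
      part \<open>0\<close>.\<close>
    moreover have "\<not> on_line ?X ?lAP"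
      by (simp add: octonion_arith)
    ultimately show False
      using Y(1) by blast
  qed
  assume bricard: "converse_bricard octonion_plane"
  have "concurrent octonion_plane {encode_line ?lAP, encode_line ?lBQ, encode_line ?lCR}"
    using bricard[unfolded converse_bricard_def, rule_format, OF tri tri' placed] coll
    unfolding Let_def joins meets by (rule mp)
  then show False
    using not_conc by blast
qed

theorem theorem4p1:
  shows "\<exists>S :: (real list, real list) plane. moufang_plane S \<and> \<not> converse_bricard S"
  using moufang_octonion_plane not_converse_bricard_octonion_plane by blast

end
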